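(* Let $k\ge 4$ be an even integer and let $m\ge 2$ be an integer with $m\equiv -1 \pmod k$. Let $P^{-}(m)$ denote the least prime factor of $m$ and assume $P^{-}(m)\ge k$. Then there is a constant $C_{m,k}>0$, depending only on $m$ and $k$, such that for all positive integers $n$, \[ r_k(\mathbb{Z}_m^n)\;\ge\; C_{m,k}\,\frac{\bigl\lfloor \frac{k-2}{k}m+2\bigr\rfloor^{n}}{n^{\lfloor \frac{k-2}{k}m+1\rfloor/2}}. \]
   Context: $\mathbb{Z}_m^n=(\mathbb{Z}/m\mathbb{Z})^n$ with componentwise addition. An arithmetic progression of length $k$ in $\mathbb{Z}_m^n$ is a sequence $\mathbf{v},\mathbf{v}+\mathbf{c},\mathbf{v}+2\mathbf{c},\dots,\mathbf{v}+(k-1)\mathbf{c}$ with $\mathbf{v},\mathbf{c}\in\mathbb{Z}_m^n$ and $\mathbf{c}\neq 0$ (i.e. a non-constant progression). $r_k(\mathbb{Z}_m^n)$ denotes the maximal size of a subset of $\mathbb{Z}_m^n$ containing no arithmetic progression of length $k$. *)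

theory Defs
  imports "HOL-Analysis.Analysis" "HOL-Number_Theory.Cong" "HOL-Library.FuncSet"
begin

(* Elements of Z_m^n are coordinate functions on {..<n} whose values are the residues
   0, ..., m-1; they are extensional (undefined outside {..<n}), so that equality of
   functions is equality of vectors. *)

definition zmod_space :: "nat \<Rightarrow> nat \<Rightarrow> (nat \<Rightarrow> int) set" where
  "zmod_space m n = {..<n} \<rightarrow>\<^sub>E {0..<int m}"

definition zmod_zero :: "nat \<Rightarrow> nat \<Rightarrow> int" where
  "zmod_zero n = (\<lambda>i\<in>{..<n}. 0)"

definition zmod_add :: "nat \<Rightarrow> nat \<Rightarrow> (nat \<Rightarrow> int) \<Rightarrow> (nat \<Rightarrow> int) \<Rightarrow> nat \<Rightarrow> int" where
  "zmod_add m n u v = (\<lambda>i\<in>{..<n}. (u i + v i) mod int m)"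

definition zmod_mult :: "nat \<Rightarrow> nat \<Rightarrow> nat \<Rightarrow> (nat \<Rightarrow> int) \<Rightarrow> nat \<Rightarrow> int" where
  "zmod_mult m n j v = (\<lambda>i\<in>{..<n}. (int j * v i) mod int m)"

definition has_progression :: "nat \<Rightarrow> nat \<Rightarrow> nat \<Rightarrow> (nat \<Rightarrow> int) set \<Rightarrow> bool" where
  "has_progression k m n S \<longleftrightarrow>
     (\<exists>v\<in>zmod_space m n. \<exists>c\<in>zmod_space m n. c \<noteq> zmod_zero n \<and>
        (\<forall>j<k. zmod_add m n v (zmod_mult m n j c) \<in> S))"

definition r_max :: "nat \<Rightarrow> nat \<Rightarrow> nat \<Rightarrow> nat" where
  "r_max k m n = Max (card ` {S. S \<subseteq> zmod_space m n \<and> \<not> has_progression k m n S})"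

definition least_prime_factor :: "nat \<Rightarrow> nat" where
  "least_prime_factor m = (LEAST p. prime p \<and> p dvd m)"

lemma finite_zmod_space: "finite (zmod_space m n)"
  unfolding zmod_space_def by (intro finite_PiE) auto

(* The maximum defining r_max is over a finite nonempty set. *)
lemma r_max_attained:
  assumes "k \<ge> 1"
  shows "\<exists>S \<subseteq> zmod_space m n. \<not> has_progression k m n S \<and> card S = r_max k m n"
proof -
  let ?A = "{S. S \<subseteq> zmod_space m n \<and> \<not> has_progression k m n S}"
  have "finite ?A"
    using finite_zmod_space by (auto intro: finite_subset[of _ "Pow (zmod_space m n)"])
  moreover have "{} \<in> ?A"
    using assms by (auto simp: has_progression_def intro: exI[of _ 0] dest: spec[of _ 0])
  ultimately have "Max (card ` ?A) \<in> card ` ?A"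
    by (intro Max_in) auto
  then show ?thesis
    unfolding r_max_def by auto
qed

lemma r_max_upper:
  assumes "S \<subseteq> zmod_space m n" "\<not> has_progression k m n S"
  shows "card S \<le> r_max k m n"
  unfolding r_max_def
proof (rule Max_ge)
  show "finite (card ` {S. S \<subseteq> zmod_space m n \<and> \<not> has_progression k m n S})"
    using finite_zmod_space
    by (auto intro!: finite_imageI intro: finite_subset[of _ "Pow (zmod_space m n)"])
qed (use assms in auto)

end

theory Submission
  imports Defs
begin

text \<open>
  Write \<open>m = k q - 1\<close> and \<open>k = 2 h + 2\<close>, and use only the digits \<open>D = {0} \<union> [q, m - q]\<close>, of which
  there are \<open>d = (k - 2) q + 1\<close>. The progression-free set consists of the words over \<open>D\<close> in
  which every digit occurs a prescribed number of times. By Dirichlet's theorem some \<open>j \<le> k - 1\<close>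
  has \<open>j c\<close> at distance less than \<open>q\<close> from \<open>0\<close>, so \<open>0\<close> is never the first term of a
  nonconstant progression in \<open>D\<close>. Likewise some \<open>j \<le> h\<close> has \<open>j c\<close> at distance less than \<open>2 q\<close>
  from \<open>0\<close>; such a step cannot jump over the gap between \<open>m - q\<close> and \<open>q\<close>, so the term with
  index \<open>h\<close> lies strictly between the terms with indices \<open>h \<plusminus> j\<close> and is not the minimum of the
  progression. As digit frequencies do not depend on the term, the digits \<open>0, q, q + 1, \<dots>\<close>
  can be excluded one after the other from the coordinates in which the progression moves.

  The frequencies are chosen by averaging: by Chebyshev's inequality at least half of the \<open>d ^ n\<close>
  words have all frequencies within \<open>sqrt (2 n)\<close> of \<open>n / d\<close>, which leaves
  \<open>O(n ^ ((d - 1) / 2))\<close> frequency vectors, since one frequency is determined by the others.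
\<close>

section \<open>Dirichlet approximation modulo \<open>m\<close>\<close>

text \<open>Pigeonhole with \<open>N + 1\<close> boxes of length \<open>m / (N + 1)\<close> for the
  residues of \<open>0, c, ..., N c\<close>. Two residues in one box give \<open>j\<close> as a
  difference of indices. Otherwise every box is hit, and a residue in the last box is close to
  \<open>m\<close> from below.\<close>

lemma bounded_multiple_near_multiple:
  fixes c :: int and m N :: nat
  assumes "m > 0" "N > 0"
  obtains j :: nat and t :: int
    where "0 < j" "j \<le> N" "int (N + 1) * \<bar>int j * c - t * int m\<bar> \<le> int m"
proof -
  define r where "r j = (int j * c) mod int m" for j :: nat
  define b where "b j = (int (N + 1) * r j) div int m" for j
  have r: "0 \<le> r j" "r j < int m" for j
    using assms(1) by (auto simp: r_def)
  have r_eq: "int j * c - r j = (int j * c) div int m * int m" for j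
    by (simp add: r_def minus_mod_eq_div_mult)
  have b: "int m * b j \<le> int (N + 1) * r j" "int (N + 1) * r j < int m * b j + int m" for j
  proof -
    have "int (N + 1) * r j = int m * b j + (int (N + 1) * r j) mod int m"
      unfolding b_def by (rule mult_div_mod_eq[symmetric])
    moreover have "0 \<le> (int (N + 1) * r j) mod int m" "(int (N + 1) * r j) mod int m < int m"
      using assms(1) by auto
    ultimately show "int m * b j \<le> int (N + 1) * r j" "int (N + 1) * r j < int m * b j + int m"
      by linarith+
  qed
  show thesis
  proof (cases "inj_on b {..N}")
    case False
    then obtain i j where ij: "i < j" "j \<le> N" "b i = b j"
      by (auto simp: inj_on_def) (metis linorder_neqE_nat)
    define t where "t = (int j * c) div int m - (int i * c) div int m"
    have "int (j - i) * c - t * int m = r j - r i"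
      using ij r_eq[of i] r_eq[of j] by (simp add: t_def of_nat_diff algebra_simps)
    moreover have "\<bar>int (N + 1) * r j - int (N + 1) * r i\<bar> \<le> int m"
      using b[of i] b[of j] unfolding ij(3) by linarith
    ultimately have "int (N + 1) * \<bar>int (j - i) * c - t * int m\<bar> \<le> int m"
      by (simp add: abs_mult flip: right_diff_distrib)
    then show thesis
      using ij by (intro that[of "j - i" t]) auto
  next
    case True
    have "b j \<in> {0..int N}" for j
    proof -
      have "int (N + 1) * r j < int (N + 1) * int m"
        using r(2)[of j] by (intro mult_strict_left_mono) auto
      then have "int m * b j < int m * int (N + 1)"
        using b(1)[of j] by (simp only: mult.commute)
      then have "b j < int (N + 1)"
        using assms(1) by (simp only: mult_less_cancel_left_pos of_nat_0_less_iff)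
      then show ?thesis
        using r(1)[of j] assms(1) by (simp add: b_def pos_imp_zdiv_nonneg_iff)
    qed
    \<comment> \<open>\<open>N + 1\<close> multiples fill \<open>N + 1\<close> boxes injectively, so
      the last box is occupied. Index \<open>0\<close> lies in box \<open>0\<close>, which is not
      the last one because \<open>N > 0\<close>.\<close>
    then have "b ` {..N} = {0..int N}"
      using True by (intro card_subset_eq) (auto simp: card_image)
    then obtain j where j: "j \<le> N" "b j = int N"
      by (metis atLeastAtMost_iff atMost_iff imageE of_nat_0_le_iff order_refl)
    have "j \<noteq> 0"
    proof
      assume "j = 0"
      then have "b j = 0"
        by (simp add: b_def r_def)
      then show False
        using j(2) assms(2) by simp
    qed
    define t where "t = (int j * c) div int m + 1"
    have "int j * c - t * int m = r j - int m"
      using r_eq[of j] by (simp add: t_def algebra_simps)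
    moreover have "int (N + 1) * (int m - r j) \<le> int m"
      using b(1)[of j] j(2) by (simp add: algebra_simps)
    ultimately have "int (N + 1) * \<bar>int j * c - t * int m\<bar> \<le> int m"
      using r(2)[of j] by simp
    then show thesis
      using j \<open>j \<noteq> 0\<close> by (intro that[of j t]) auto
  qed
qed

lemma coprime_below_least_prime_factor:
  assumes "0 < j" "j < least_prime_factor m"
  shows "coprime j m"
proof (rule coprimeI)
  fix e assume e: "e dvd j" "e dvd m"
  show "is_unit e"
  proof (rule ccontr)
    assume "\<not> is_unit e"
    then obtain p where p: "prime p" "p dvd e"
      using prime_factor_nat by auto
    then have "least_prime_factor m \<le> p"
      unfolding least_prime_factor_def using e by (intro Least_le) auto
    moreover have "p \<le> j"
      using p e assms by (meson dvd_imp_le dvd_trans)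
    ultimately show False
      using assms by simp
  qed
qed

section \<open>Letter frequencies of words over a finite alphabet\<close>

definition letter_count :: "nat \<Rightarrow> (nat \<Rightarrow> 'a) \<Rightarrow> 'a \<Rightarrow> nat" where
  "letter_count n x a = card {i \<in> {..<n}. x i = a}"

lemma sum_letter_count:
  assumes "finite D" "x \<in> {..<n} \<rightarrow>\<^sub>E D"
  shows "(\<Sum>a\<in>D. letter_count n x a) = n"
proof -
  have "(\<Sum>a\<in>D. letter_count n x a) = card (\<Union>a\<in>D. {i \<in> {..<n}. x i = a})"
    unfolding letter_count_def using assms(1) by (subst card_UN_disjoint) auto
  also have "(\<Union>a\<in>D. {i \<in> {..<n}. x i = a}) = {..<n}"
    using assms(2) by auto
  finally show ?thesis by simp
qed

lemma sum_PiE_lessThan_Suc: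
  fixes g :: "(nat \<Rightarrow> 'a) \<Rightarrow> real"
  shows "(\<Sum>x\<in>{..<Suc n} \<rightarrow>\<^sub>E D. g x) = (\<Sum>y\<in>D. \<Sum>x\<in>{..<n} \<rightarrow>\<^sub>E D. g (x(n := y)))"
proof -
  have inj: "inj_on (\<lambda>(y, x). x(n := y)) (D \<times> ({..<n} \<rightarrow>\<^sub>E D))"
    by (rule inj_combinator) simp
  have "{..<Suc n} \<rightarrow>\<^sub>E D = (\<lambda>(y, x). x(n := y)) ` (D \<times> ({..<n} \<rightarrow>\<^sub>E D))"
    unfolding lessThan_Suc by (rule PiE_insert_eq)
  then have "(\<Sum>x\<in>{..<Suc n} \<rightarrow>\<^sub>E D. g x)
      = sum (g \<circ> (\<lambda>(y, x). x(n := y))) (D \<times> ({..<n} \<rightarrow>\<^sub>E D))"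
    by (simp only: sum.reindex[OF inj])
  then show ?thesis
    by (simp add: sum.cartesian_product case_prod_unfold o_def)
qed

text \<open>For a uniform word the values \<open>f (x i)\<close> are independent with mean 0, so the
  second moment is additive. Both claims go through one induction because the first kills the cross
  term of the second; the factor \<open>card D\<close> avoids the exponent
  \<open>n - 1\<close>.\<close>

lemma second_moment_sum_letters:
  fixes f :: "'a \<Rightarrow> real"
  assumes "finite D" "sum f D = 0"
  shows "(\<Sum>x\<in>{..<n} \<rightarrow>\<^sub>E D. \<Sum>i<n. f (x i)) = 0"
    and "real (card D) * (\<Sum>x\<in>{..<n} \<rightarrow>\<^sub>E D. (\<Sum>i<n. f (x i))\<^sup>2)
           = real n * real (card D) ^ n * (\<Sum>y\<in>D. (f y)\<^sup>2)"
proof (induction n)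
  case (Suc n)
  let ?W = "{..<n} \<rightarrow>\<^sub>E D"
  let ?s = "\<lambda>x. \<Sum>i<n. f (x i)"
  have card_W: "real (card ?W) = real (card D) ^ n"
    by (simp add: card_PiE)
  have upd: "(\<Sum>i<Suc n. f ((x(n := y)) i)) = ?s x + f y" for x y
    by simp
  {
    case 1
    show ?case
      unfolding sum_PiE_lessThan_Suc upd
      using Suc(1) assms(2) by (simp add: sum.distrib flip: sum_distrib_left)
  next
    case 2
    have "(\<Sum>x\<in>{..<Suc n} \<rightarrow>\<^sub>E D. (\<Sum>i<Suc n. f (x i))\<^sup>2)
      = (\<Sum>y\<in>D. (\<Sum>x\<in>?W. (?s x)\<^sup>2) + 2 * f y * (\<Sum>x\<in>?W. ?s x) + real (card ?W) * (f y)\<^sup>2)"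
      unfolding sum_PiE_lessThan_Suc upd
      by (intro sum.cong refl)
        (simp add: power2_sum sum.distrib sum_distrib_left algebra_simps)
    also have "\<dots> = real (card D) * (\<Sum>x\<in>?W. (?s x)\<^sup>2) + real (card D) ^ n * (\<Sum>y\<in>D. (f y)\<^sup>2)"
      using Suc(1) by (simp add: sum.distrib card_W flip: sum_distrib_left)
    finally show ?case
      using Suc(2) by (simp add: algebra_simps)
  }
qed auto

lemma sum_square_letter_deviation:
  assumes "finite D" "a \<in> D"
  shows "(\<Sum>x\<in>{..<n} \<rightarrow>\<^sub>E D. (real (card D) * real (letter_count n x a) - real n)\<^sup>2)
           = real n * real (card D) ^ n * (real (card D) - 1)"
proof -
  define d where "d = real (card D)"
  \<comment> \<open>\<open>d\<close> times the centred indicator of the letter \<open>a\<close>: it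
    sums to 0 over \<open>D\<close>, and its sum along a word is the deviation in the
    statement.\<close>
  define f where "f y = (if y = a then d else 0) - 1" for y
  have d: "d \<noteq> 0"
    using assms by (auto simp: d_def)
  have "sum f D = 0"
    using assms by (simp add: f_def sum_subtractf d_def)
  have "(f y)\<^sup>2 = (if y = a then d\<^sup>2 - 2 * d else 0) + 1" for y
    by (simp add: f_def power2_eq_square algebra_simps)
  then have f2: "(\<Sum>y\<in>D. (f y)\<^sup>2) = d * (d - 1)"
    using assms by (simp add: sum.distrib power2_eq_square algebra_simps flip: d_def)
  have "(\<Sum>i<n. f (x i)) = d * real (letter_count n x a) - real n" for x
  proof -
    have "(\<Sum>i<n. if x i = a then d else 0) = (\<Sum>i\<in>{i\<in>{..<n}. x i = a}. d)"
      by (simp only: sum.inter_filter finite_lessThan)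
    then show ?thesis
      by (simp add: f_def sum_subtractf letter_count_def)
  qed
  then have "d * (\<Sum>x\<in>{..<n} \<rightarrow>\<^sub>E D. (d * real (letter_count n x a) - real n)\<^sup>2)
      = d * (real n * d ^ n * (d - 1))"
    using second_moment_sum_letters(2)[OF assms(1) \<open>sum f D = 0\<close>, of n]
    by (simp only: f2 mult_ac flip: d_def)
  then show ?thesis
    using d by (simp add: d_def)
qed

lemma card_nats_near_le:
  fixes u s :: real
  assumes "s \<ge> 0"
  shows "finite {t::nat. \<bar>real t - u\<bar> \<le> s}" "real (card {t::nat. \<bar>real t - u\<bar> \<le> s}) \<le> 2 * s + 1"
proof -
  let ?T = "{t::nat. \<bar>real t - u\<bar> \<le> s}"
  have sub: "int ` ?T \<subseteq> {\<lceil>u - s\<rceil>..\<lfloor>u + s\<rfloor>}"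
    by (auto simp: ceiling_le_iff le_floor_iff abs_le_iff)
  then show "finite ?T"
    by (meson finite_atLeastAtMost_int finite_imageD finite_subset inj_on_of_nat)
  have "card ?T = card (int ` ?T)"
    by (simp add: card_image)
  also have "\<dots> \<le> nat (\<lfloor>u + s\<rfloor> - \<lceil>u - s\<rceil> + 1)"
    using card_mono[OF _ sub] by simp
  finally have "real (card ?T) \<le> real (nat (\<lfloor>u + s\<rfloor> - \<lceil>u - s\<rceil> + 1))"
    by simp
  also have "\<dots> \<le> 2 * s + 1"
    using assms by linarith
  finally show "real (card ?T) \<le> 2 * s + 1" .
qed

lemma large_frequency_class:
  fixes D :: "'a set"
  assumes "finite D" "D \<noteq> {}" "n \<ge> 1"
  obtains w where
    "real (card D) ^ n \<le> 2 * (4 * sqrt (real n)) ^ (card D - 1) *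
       real (card {x \<in> {..<n} \<rightarrow>\<^sub>E D. \<forall>a\<in>D. letter_count n x a = w a})"
proof -
  define W where "W = {..<n} \<rightarrow>\<^sub>E D"
  define d where "d = real (card D)"
  define dev where "dev x = (\<Sum>a\<in>D. (d * real (letter_count n x a) - real n)\<^sup>2)" for x
  \<comment> \<open>The mean of \<open>dev\<close> is at most \<open>n * d^2\<close>. At twice this
    threshold Markov's inequality puts at most half of the words outside \<open>G\<close>.\<close>
  define G where "G = {x \<in> W. dev x \<le> 2 * real n * d\<^sup>2}"
  have d: "d \<ge> 1"
    using assms by (simp add: d_def Suc_le_eq card_gt_0_iff)
  have fin_W: "finite W"
    using assms by (simp add: W_def finite_PiE)
  have card_W: "real (card W) = d ^ n"
    by (simp add: W_def d_def card_PiE)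
  have dev_nonneg: "dev x \<ge> 0" for x
    by (simp add: dev_def sum_nonneg)
  have "sum dev W = (\<Sum>a\<in>D. \<Sum>x\<in>W. (d * real (letter_count n x a) - real n)\<^sup>2)"
    unfolding dev_def by (rule sum.swap)
  also have "\<dots> = (\<Sum>a\<in>D. real n * d ^ n * (d - 1))"
    unfolding W_def d_def using assms(1) by (intro sum.cong refl sum_square_letter_deviation)
  also have "\<dots> = d * (real n * d ^ n * (d - 1))"
    by (simp add: d_def)
  also have "\<dots> \<le> d * (real n * d ^ n * d)"
    using d by (intro mult_left_mono) auto
  finally have dev_W: "sum dev W \<le> real n * d\<^sup>2 * d ^ n"
    by (simp add: power2_eq_square mult_ac)
  have "real (card (W - G)) * (2 * real n * d\<^sup>2) \<le> sum dev (W - G)"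
    by (intro sum_bounded_below[where 'a = real, simplified]) (auto simp: G_def)
  also have "\<dots> \<le> sum dev W"
    using fin_W dev_nonneg by (intro sum_mono2) auto
  finally have "(real n * d\<^sup>2) * (2 * real (card (W - G))) \<le> (real n * d\<^sup>2) * d ^ n"
    using dev_W by (simp add: mult_ac)
  then have "2 * real (card (W - G)) \<le> d ^ n"
    using assms(3) d by (subst (asm) mult_le_cancel_left_pos) auto
  moreover have "card W = card G + card (W - G)"
    using fin_W by (subst card_Diff_subset) (auto simp: G_def card_mono intro: finite_subset)
  ultimately have card_G: "d ^ n \<le> 2 * real (card G)"
    using card_W by simp
  have fin_G: "finite G"
    using fin_W by (simp add: G_def)
  have "real (card G) > 0"
    using card_G d by (smt (verit) zero_less_power)
  then have "G \<noteq> {}"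
    by auto

  \<comment> \<open>Chosen so that the bound defining \<open>G\<close> is \<open>(s * d)^2\<close>;
    hence each frequency is within \<open>s\<close> of \<open>n / d\<close>. As
    \<open>sqrt 2 \<le> 3 / 2\<close> and \<open>n \<ge> 1\<close>, the \<open>2 * s + 1\<close>
    candidates number at most \<open>4 * sqrt n\<close>.\<close>
  define s where "s = sqrt (2 * real n)"
  define T where "T = {t::nat. \<bar>real t - real n / d\<bar> \<le> s}"
  have "s \<ge> 0"
    by (simp add: s_def)
  have fin_T: "finite T" and "real (card T) \<le> 2 * s + 1"
    unfolding T_def using card_nats_near_le[OF \<open>s \<ge> 0\<close>] by auto
  moreover have "s \<le> 3 / 2 * sqrt (real n)"
    unfolding s_def by (rule real_le_lsqrt) (auto simp: power_mult_distrib power2_eq_square)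
  moreover have "1 \<le> sqrt (real n)"
    using assms(3) by simp
  ultimately have card_T: "real (card T) \<le> 4 * sqrt (real n)"
    by linarith

  obtain a0 where a0: "a0 \<in> D"
    using assms(2) by blast
  \<comment> \<open>One letter \<open>a0\<close> is left out, since its frequency follows from the
    others; this gives the exponent \<open>card D - 1\<close>.\<close>
  define f where "f x = restrict (letter_count n x) (D - {a0})" for x
  define B where "B = (D - {a0}) \<rightarrow>\<^sub>E T"
  have in_T: "letter_count n x a \<in> T" if "x \<in> G" "a \<in> D" for x a
  proof -
    let ?e = "d * real (letter_count n x a) - real n"
    have "?e\<^sup>2 \<le> dev x"
      unfolding dev_def using assms(1) that(2)
      by (intro member_le_sum[where f = "\<lambda>a. (d * real (letter_count n x a) - real n)\<^sup>2"]) auto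
    also have "\<dots> \<le> (s * d)\<^sup>2"
      using that(1) by (simp add: G_def s_def power_mult_distrib)
    finally have "\<bar>?e\<bar> \<le> s * d"
      using d \<open>s \<ge> 0\<close> by (simp add: abs_le_square_iff[symmetric])
    moreover have "real (letter_count n x a) - real n / d = ?e / d"
      using d by (simp add: field_simps)
    ultimately show ?thesis
      using d by (simp add: T_def abs_divide divide_le_eq)
  qed
  have f: "f \<in> G \<rightarrow> B"
    using in_T by (auto simp: f_def B_def)
  have fin_B: "finite B"
    using assms(1) fin_T by (simp add: B_def finite_PiE)
  have "B \<noteq> {}"
    using f \<open>G \<noteq> {}\<close> by auto
  have "real (card B) = real (card T) ^ (card D - 1)"
    using assms(1) a0 by (simp add: B_def card_PiE)
  also have "\<dots> \<le> (4 * sqrt (real n)) ^ (card D - 1)"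
    using card_T by (intro power_mono) auto
  finally have card_B: "real (card B) \<le> (4 * sqrt (real n)) ^ (card D - 1)" .
  obtain y where y: "y \<in> B" "card G \<le> card (f -` {y} \<inter> G) * card B"
    using pigeonhole_card[OF f fin_G fin_B \<open>B \<noteq> {}\<close>] by blast
  \<comment> \<open>The frequency of \<open>a0\<close> is restored from the total \<open>n\<close>;
    the truncated subtraction is exact for every word in the fibre over \<open>y\<close>.\<close>
  define w where "w a = (if a = a0 then n - (\<Sum>b\<in>D - {a0}. y b) else y a)" for a
  let ?S = "{x \<in> {..<n} \<rightarrow>\<^sub>E D. \<forall>a\<in>D. letter_count n x a = w a}"
  have "f -` {y} \<inter> G \<subseteq> ?S"
  proof
    fix x assume x: "x \<in> f -` {y} \<inter> G"
    then have xW: "x \<in> {..<n} \<rightarrow>\<^sub>E D"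
      by (auto simp: G_def W_def)
    have count: "letter_count n x a = y a" if "a \<in> D - {a0}" for a
      using x that by (auto simp: f_def)
    have "n = letter_count n x a0 + (\<Sum>b\<in>D - {a0}. y b)"
      using sum_letter_count[OF assms(1) xW] sum.remove[OF assms(1) a0, of "letter_count n x"] count
      by simp
    then show "x \<in> ?S"
      using xW count by (auto simp: w_def)
  qed
  moreover have "finite ?S"
    using fin_W by (simp add: W_def)
  ultimately have "card (f -` {y} \<inter> G) \<le> card ?S"
    by (intro card_mono)
  then have "card G \<le> card ?S * card B"
    using y(2) by (meson le_trans mult_le_mono1)
  then have "real (card G) \<le> real (card ?S) * real (card B)"
    by (simp flip: of_nat_mult)
  also have "\<dots> \<le> real (card ?S) * (4 * sqrt (real n)) ^ (card D - 1)"
    using card_B by (intro mult_left_mono) auto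
  finally show thesis
    using card_G by (intro that[of w]) (simp add: d_def mult_ac)
qed

section \<open>Progressions of digits in one coordinate\<close>

text \<open>The only allowed digit at distance less than \<open>q\<close> from 0 modulo
  \<open>m\<close> is 0 itself. So the short multiple \<open>j c\<close> vanishes modulo
  \<open>m\<close>, and \<open>j\<close> can be cancelled.\<close>

lemma zero_not_first_term:
  fixes c :: int and k m q :: nat
  assumes k: "k \<ge> 2" and m: "m + 1 = k * q"
    and coprime: "\<And>j. 0 < j \<Longrightarrow> j < k \<Longrightarrow> coprime j m"
    and AP: "\<And>j. j < k \<Longrightarrow> (int j * c) mod int m \<in> insert 0 {int q..int m - int q}"
  shows "int m dvd c"
proof (cases "m = 0")
  case True
  then have "k = 1"
    using m by simp
  then show ?thesis
    using k by simp
next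
  case False
  obtain j t where j: "0 < j" "j \<le> k - 1"
    and le: "int (k - 1 + 1) * \<bar>int j * c - t * int m\<bar> \<le> int m"
    using bounded_multiple_near_multiple[of m "k - 1" c] False k by auto
  define s where "s = int j * c - t * int m"
  \<comment> \<open>The congruence condition on \<open>m\<close> makes this strict:
    \<open>m = k q - 1 < k q\<close>.\<close>
  have "int k * \<bar>s\<bar> < int k * int q"
    using le k m by (simp add: s_def flip: of_nat_mult)
  then have s: "\<bar>s\<bar> < int q"
    using k by simp
  have "q \<le> m"
  proof -
    have "2 * q \<le> k * q"
      using k by simp
    then show ?thesis
      using m False by linarith
  qed
  have "(int j * c) mod int m = s mod int m"
    by (simp add: s_def mod_diff_right_eq[symmetric, of "int j * c" "t * int m"])
  then have D: "s mod int m \<in> insert 0 {int q..int m - int q}"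
    using AP[of j] j k by simp
  have "s = 0"
  proof (rule ccontr)
    assume "s \<noteq> 0"
    then consider "s > 0" | "s < 0" by linarith
    then show False
    proof cases
      case 1
      then have "s mod int m = s"
        using s \<open>q \<le> m\<close> by simp
      then show False
        using D 1 s by simp
    next
      case 2
      then have "s mod int m = s + int m"
        using s \<open>q \<le> m\<close> by (intro int_mod_pos_eq[of _ _ "-1"]) auto
      then show False
        using D 2 s \<open>q \<le> m\<close> by simp
    qed
  qed
  then have "int m dvd int j * c"
    by (simp add: s_def)
  moreover have "coprime (int m) (int j)"
    using coprime[of j] j k by (simp add: coprime_commute)
  ultimately show ?thesis
    by (simp add: coprime_dvd_mult_right_iff)
qed

text \<open>Some \<open>j c\<close> with \<open>j \<le> h\<close> is congruent to \<open>s\<close>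
  with \<open>\<bar>s\<bar> < 2 q\<close>. Unless \<open>s = 0\<close>, going \<open>j\<close>
  indices forward or backward from \<open>h\<close>, according to the sign of \<open>s\<close>,
  would lead below the minimum. Both indices are available because \<open>h\<close> is in the
  middle.\<close>

lemma minimum_not_middle_term:
  fixes v c a :: int and h m q :: nat
  assumes h: "h > 0" and "m > 0" and m: "m + 1 = 2 * (h + 1) * q"
    and coprime: "\<And>j. 0 < j \<Longrightarrow> j \<le> h \<Longrightarrow> coprime j m"
    and AP: "\<And>j. j \<le> 2 * h \<Longrightarrow> (v + int j * c) mod int m \<in> {a..int m - int q}"
    and middle: "(v + int h * c) mod int m = a" and a: "int q \<le> a"
  shows "int m dvd c"
proof -
  obtain j t where j: "0 < j" "j \<le> h" and le: "int (h + 1) * \<bar>int j * c - t * int m\<bar> \<le> int m"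
    using bounded_multiple_near_multiple[of m h c] assms by auto
  define s where "s = int j * c - t * int m"
  have "int m + 1 = int (h + 1) * (2 * int q)"
    using arg_cong[OF m, of int] by (simp add: algebra_simps)
  then have "int (h + 1) * \<bar>s\<bar> < int (h + 1) * (2 * int q)"
    using le unfolding s_def by linarith
  then have s: "\<bar>s\<bar> < 2 * int q"
    by (simp only: mult_less_cancel_left_pos of_nat_0_less_iff zero_less_Suc Suc_eq_plus1[symmetric])
  \<comment> \<open>A descent \<open>e\<close> from \<open>a\<close> would have to wrap around to
    reach \<open>y\<close>, but \<open>y \<le> m - q\<close>, \<open>a \<ge> q\<close> and
    \<open>\<bar>e\<bar> < 2 q\<close> put \<open>y - (a + e)\<close> strictly between 0 and
    \<open>m\<close>.\<close>
  have no_descent: False if y: "y \<in> {a..int m - int q}" and cong: "int m dvd y - (a + e)"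
    and e: "e < 0" "\<bar>e\<bar> = \<bar>s\<bar>" for y e
  proof -
    have "0 < y - (a + e)" "y - (a + e) < int m"
      using y e s a by auto
    then show False
      using cong by (meson zdvd_not_zless)
  qed
  have term_cong: "int m dvd (v + i * c) mod int m - (a + (i - int h) * c)" for i
  proof -
    have "[(v + i * c) mod int m = v + i * c] (mod int m)"
      by (simp add: cong_def)
    moreover have "[v + int h * c = a] (mod int m)"
      using middle by (auto simp: cong_def)
    then have "[v + int h * c + (i - int h) * c = a + (i - int h) * c] (mod int m)"
      by (intro cong_add) auto
    moreover have "v + int h * c + (i - int h) * c = v + i * c"
      by (simp add: algebra_simps)
    ultimately show ?thesis
      by (metis cong_iff_dvd_diff cong_trans)
  qed
  have "s = 0"
  proof (rule ccontr)
    assume "s \<noteq> 0"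
    then consider "s < 0" | "- s < 0" by linarith
    then show False
    proof cases
      case 1
      let ?y = "(v + int (h + j) * c) mod int m"
      have "?y - (a + s) = ?y - (a + (int (h + j) - int h) * c) + t * int m"
        by (simp add: s_def)
      then have "int m dvd ?y - (a + s)"
        using term_cong[of "int (h + j)"] by (metis dvd_add dvd_triv_right)
      then show False
        using no_descent[of ?y s] AP[of "h + j"] j 1 by auto
    next
      case 2
      let ?y = "(v + int (h - j) * c) mod int m"
      have "?y - (a + - s) = ?y - (a + (int (h - j) - int h) * c) + (- t) * int m"
        using j by (simp add: s_def of_nat_diff algebra_simps)
      then have "int m dvd ?y - (a + - s)"
        using term_cong[of "int (h - j)"] by (metis dvd_add dvd_triv_right)
      then show False
        using no_descent[of ?y "- s"] AP[of "h - j"] j 2 by auto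
    qed
  qed
  then have "int m dvd int j * c"
    by (simp add: s_def)
  moreover have "coprime (int m) (int j)"
    using coprime[of j] j by (simp add: coprime_commute)
  ultimately show ?thesis
    by (simp add: coprime_dvd_mult_right_iff)
qed

lemma frequency_class_progression_free:
  fixes h k m n q :: nat and w :: "int \<Rightarrow> nat"
  defines "D \<equiv> insert 0 {int q..int m - int q}"
  assumes h: "h > 0" and k: "k = 2 * h + 2" and "m > 0" and m: "m + 1 = k * q"
    and coprime: "\<And>j. 0 < j \<Longrightarrow> j < k \<Longrightarrow> coprime j m"
  shows "\<not> has_progression k m n {x \<in> {..<n} \<rightarrow>\<^sub>E D. \<forall>a\<in>D. letter_count n x a = w a}"
proof
  let ?S = "{x \<in> {..<n} \<rightarrow>\<^sub>E D. \<forall>a\<in>D. letter_count n x a = w a}"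
  assume "has_progression k m n ?S"
  then obtain v c where v: "v \<in> zmod_space m n" and c: "c \<in> zmod_space m n" "c \<noteq> zmod_zero n"
    and in_S: "\<And>j. j < k \<Longrightarrow> zmod_add m n v (zmod_mult m n j c) \<in> ?S"
    unfolding has_progression_def by blast
  define x where "x j = zmod_add m n v (zmod_mult m n j c)" for j
  have x: "x j i = (v i + int j * c i) mod int m" if "i < n" for i j
    using that by (simp add: x_def zmod_add_def zmod_mult_def mod_add_right_eq)
  have x_D: "x j i \<in> D" if "j < k" "i < n" for i j
    using in_S[OF that(1)] that(2) unfolding x_def by (auto dest!: PiE_mem)
  have c_zero: "c i = 0" if "i < n" "int m dvd c i" for i
  proof -
    have "c i \<in> {0..<int m}"
      using PiE_mem[OF c(1)[unfolded zmod_space_def]] that(1) by simp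
    then show ?thesis
      using that(2) zdvd_not_zless[of "c i" "int m"] by force
  qed
  \<comment> \<open>If the digit \<open>a\<close> occurs in position \<open>p\<close> only where the progression is constant, then the
    occurrences of \<open>a\<close> in position \<open>p\<close> persist in every position \<open>j\<close>, and since the number
    of occurrences does not depend on the position there are no others.\<close>
  have propagate: "c i = 0"
    if p: "p < k" "\<And>i. i < n \<Longrightarrow> x p i = a \<Longrightarrow> c i = 0" and j: "j < k" "i < n" "x j i = a"
    for p a i j
  proof -
    let ?occ = "\<lambda>j. {i \<in> {..<n}. x j i = a}"
    have "a \<in> D"
      using x_D j by blast
    then have card: "card (?occ l) = w a" if "l < k" for l
      using in_S[OF that] by (simp add: letter_count_def x_def)
    have "x j i = x p i" if "i < n" "x p i = a" for i
      using p(2)[OF that] x[OF that(1)] by simp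
    then have "?occ p \<subseteq> ?occ j"
      by auto
    then have "?occ p = ?occ j"
      using card p(1) j(1) by (intro card_subset_eq) auto
    then show ?thesis
      using p(2) j by blast
  qed
  \<comment> \<open>The induction runs over all naturals; values outside \<open>D\<close> never
    occur as digits. The pivot position is \<open>0\<close> for the digit 0 and \<open>h\<close> for
    the others, and \<open>propagate\<close> carries the result to all positions.\<close>
  have "\<forall>j<k. \<forall>i<n. x j i = int a \<longrightarrow> c i = 0" for a
  proof (induction a rule: less_induct)
    case (less a)
    show ?case
    proof (cases "a = 0")
      case True
      have "c i = 0" if i: "i < n" "x 0 i = int a" for i
      proof -
        have "v i mod int m = 0"
          using i True x[of i 0] by simp
        \<comment> \<open>A progression starting at 0 consists of the multiples of its
          difference.\<close>
        then have "(int j * c i) mod int m = x j i" for j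
          using x[OF i(1), of j] by (metis add_0 mod_add_left_eq)
        then have "int m dvd c i"
          using zero_not_first_term[OF _ m coprime, of "c i"] x_D i(1) k unfolding D_def by simp
        then show ?thesis
          using c_zero i by blast
      qed
      then show ?thesis
        using propagate[of 0 "int a"] k by auto
    next
      case False
      have "c i = 0" if i: "i < n" "x h i = int a" for i
      proof (rule ccontr)
        assume nz: "c i \<noteq> 0"
        \<comment> \<open>Where \<open>c i\<close> is nonzero, the induction hypothesis excludes all
          smaller digits from every position, so \<open>a\<close> is the minimum there.\<close>
        have ge: "x j i \<in> {int a..int m - int q}" if "j < k" for j
        proof -
          have "x j i \<ge> 0"
            using x_D[OF that i(1)] by (auto simp: D_def)
          then have "x j i \<ge> int a"
            using less nz i(1) that by (metis nat_0_le nat_less_iff not_le)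
          then show ?thesis
            using x_D[OF that i(1)] False by (auto simp: D_def)
        qed
        have "int q \<le> int a"
          using x_D[of h i] i k False by (auto simp: D_def)
        then have "int m dvd c i"
          using minimum_not_middle_term[of h m q "v i" "c i" "int a"] h \<open>m > 0\<close> m k coprime ge
            i(2) x[OF i(1)] by simp
        then show False
          using c_zero i(1) nz by blast
      qed
      then show ?thesis
        using propagate[of h "int a"] k by auto
    qed
  qed
  moreover have "x 0 i \<ge> 0" if "i < n" for i
    using x_D[of 0 i] that k by (auto simp: D_def)
  ultimately have "c i = 0" if "i < n" for i
    using that k by (metis nat_0_le zero_less_Suc add_2_eq_Suc')
  then have "c = zmod_zero n"
    using c(1) unfolding zmod_space_def zmod_zero_def
    by (intro extensionalityI[of _ "{..<n}"]) (auto simp: PiE_def)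
  then show False
    using c(2) by contradiction
qed

theorem theorem1p2:
  fixes k m :: nat
  assumes "k \<ge> 4" and "even k"
    and "m \<ge> 2" and "[int m = - 1] (mod int k)"
    and "least_prime_factor m \<ge> k"
  shows "\<exists>C::real. C > 0 \<and> (\<forall>n::nat. n \<ge> 1 \<longrightarrow>
           real (r_max k m n) \<ge>
             C * (real_of_int \<lfloor>(real k - 2) / real k * real m + 2\<rfloor> ^ n
                  / real n powr (real_of_int \<lfloor>(real k - 2) / real k * real m + 1\<rfloor> / 2)))"
proof -
  have "int k dvd int (m + 1)"
    using assms(4) by (simp add: cong_iff_dvd_diff add.commute)
  then obtain q where m: "m + 1 = k * q"
    using int_dvd_int_iff by blast
  define h where "h = k div 2 - 1"
  have h: "h > 0" "k = 2 * h + 2"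
    using assms(1,2) by (auto simp: h_def)
  have coprime: "coprime j m" if "0 < j" "j < k" for j
    using that assms(5) by (intro coprime_below_least_prime_factor) auto
  define D where "D = insert 0 {int q..int m - int q}"
  \<comment> \<open>The size of the digit interval from \<open>q\<close> to \<open>m - q\<close>;
    the digit 0 makes it \<open>e + 1\<close>.\<close>
  define e where "e = (k - 2) * q"
  have "q > 0"
    using m by (cases q) auto
  have m_eq: "m = e + 2 * q - 1"
    using m h by (simp add: e_def algebra_simps)
  have "e > 0"
    using h \<open>q > 0\<close> by (simp add: e_def)
  have "card D = e + 1"
    using \<open>q > 0\<close> \<open>e > 0\<close> by (simp add: D_def m_eq of_nat_diff)
  have "D \<subseteq> {0..<int m}"
    using \<open>q > 0\<close> assms(3) by (auto simp: D_def)
  \<comment> \<open>Substituting \<open>m = k q - 1\<close> leaves the fractional part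
    \<open>2 / k\<close>, so the two floors are exactly \<open>card D\<close> and
    \<open>card D - 1\<close>.\<close>
  have "(real k - 2) / real k * real m = real e - 1 + 2 / real k"
  proof -
    have "real m = real k * real q - 1"
      using arg_cong[OF m, of real] by simp
    moreover have "real e = (real k - 2) * real q"
      using assms(1) by (simp add: e_def of_nat_diff)
    ultimately show ?thesis
      using assms(1) by (simp only: \<open>real m = _\<close> \<open>real e = _\<close>) (simp add: field_simps)
  qed
  moreover have "0 \<le> 2 / real k" "2 / real k < 1"
    using assms(1) by auto
  ultimately have floor: "\<lfloor>(real k - 2) / real k * real m + 2\<rfloor> = int (card D)"
    "\<lfloor>(real k - 2) / real k * real m + 1\<rfloor> = int e"
    unfolding \<open>card D = e + 1\<close> by (intro floor_unique; simp)+
  \<comment> \<open>The 2 is the loss from keeping half of the words, and \<open>4 ^ e\<close> comes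
    from the \<open>4 * sqrt n\<close> choices for each of \<open>e\<close> frequencies.\<close>
  have bound: "real (card D) ^ n / (2 * 4 ^ e * real n powr (real e / 2)) \<le> real (r_max k m n)"
    if n: "n \<ge> 1" for n
  proof -
    obtain w where w: "real (card D) ^ n \<le> 2 * (4 * sqrt (real n)) ^ (card D - 1) *
       real (card {x \<in> {..<n} \<rightarrow>\<^sub>E D. \<forall>a\<in>D. letter_count n x a = w a})"
      using large_frequency_class[of D n] n by (auto simp: D_def)
    let ?S = "{x \<in> {..<n} \<rightarrow>\<^sub>E D. \<forall>a\<in>D. letter_count n x a = w a}"
    have "\<not> has_progression k m n ?S"
      unfolding D_def using h m coprime assms(3)
      by (intro frequency_class_progression_free[of h]) auto
    moreover have "?S \<subseteq> zmod_space m n"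
      unfolding zmod_space_def using PiE_mono[of "{..<n}" "\<lambda>_. D"] \<open>D \<subseteq> {0..<int m}\<close> by blast
    ultimately have "card ?S \<le> r_max k m n"
      by (intro r_max_upper)
    moreover have "sqrt (real n) ^ e = real n powr (real e / 2)"
      using n by (simp add: powr_half_sqrt[symmetric] powr_powr flip: powr_realpow)
    then have "real (card D) ^ n \<le> 2 * 4 ^ e * real n powr (real e / 2) * real (card ?S)"
      using w by (simp add: \<open>card D = e + 1\<close> power_mult_distrib)
    then have "real (card D) ^ n / (2 * 4 ^ e * real n powr (real e / 2)) \<le> real (card ?S)"
      using n by (simp add: pos_divide_le_eq mult_ac)
    ultimately show ?thesis
      by simp
  qed
  show ?thesis
    unfolding floor
    by (intro exI[of _ "1 / (2 * 4 ^ e)"] conjI allI impI)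
      (use bound in \<open>simp_all add: mult_ac\<close>)
qed

end
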